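(* There is a constant $K>0$ such that, for all sufficiently large $n$, $$U^{oracle}_{start}\in\Big[\frac{\sqrt{2\log2}}{\sqrt{C_{sum}+K}}\sqrt n,\ \frac{\sqrt{2\log2}}{\sqrt{C_{sum}}}\sqrt n\Big],$$ and, for $r\in(1,2]$, $U^{oracle}_{start}<U_n$, where $U_n=\sqrt{\frac{r-1}{M}\,n\log n}$.
   Context: $X=(X_t)_{t\ge0}$ is a two-dimensional Lévy process with triplet $(b,C,F)$ (drift $b\in\mathbb R^2$, covariance matrix $C=(C^{ij})_{i,j=1,2}$, Lévy measure $F$ on $\mathbb R^2$), satisfying for some $M>0$ and co-jump activity index $r$: $\|C\|_\infty+\int_{\mathbb R^2}(1\wedge|x_1x_2|^{r/2})F(dx_1,dx_2)<M$, where $\|C\|_\infty=\max(|C^{11}+C^{12}|,|C^{21}+C^{22}|)$. $\phi_n(\mathbf u)=\mathbb E[e^{i\langle\mathbf u,X_{1/n}\rangle}]$, and $\phi_n(U):=\phi_n((U,U))$ for $U\in\mathbb R$. $C_{sum}=\sum_{i,j}C^{ij}$ is the sum of all entries of $C$ (positive, so that the interval is well defined). $U^{oracle}_{start}=\inf\{U>0:|\phi_n(U)|\le\frac12\}$. Standing assumption (quasi-monotonicity): there are a function $g$, non-decreasing on $\mathbb R^-$ and non-increasing on $\mathbb R^+$, and positive constants $L,L'$ with $L\,g(U)\le|\phi_n(\mathbf u)|\le L'g(U)$ for all $\mathbf u=(U,U)$ and all $\mathbf u=(U,-U)$, $U\in\mathbb R$. *)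

theory Defs
  imports "HOL-Probability.Probability"
begin

definition cadlag :: "(real \<Rightarrow> 'a::topological_space) \<Rightarrow> bool" where
  "cadlag f \<longleftrightarrow>
     (\<forall>t\<ge>0. (f \<longlongrightarrow> f t) (at_right t)) \<and> (\<forall>t>0. \<exists>l. (f \<longlongrightarrow> l) (at_left t))"

text \<open>Time is indexed by all of \<open>real\<close>, but only the values at times \<open>t \<ge> 0\<close> are constrained.\<close>

locale levy_process = prob_space P
  for P :: "'w measure" and X :: "real \<Rightarrow> 'w \<Rightarrow> real ^ 'd" +
  assumes measurable_X: "\<And>t. 0 \<le> t \<Longrightarrow> random_variable borel (X t)"
    and start_0: "AE \<omega> in P. X 0 \<omega> = 0"
    and indep_increments: "\<And>(t :: nat \<Rightarrow> real) k. 0 \<le> t 0 \<Longrightarrow> (\<And>i. i < k \<Longrightarrow> t i < t (Suc i)) \<Longrightarrow>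
      indep_vars (\<lambda>_. borel) (\<lambda>i \<omega>. X (t (Suc i)) \<omega> - X (t i) \<omega>) {..<k}"
    and stationary_increments: "\<And>s t. 0 \<le> s \<Longrightarrow> 0 \<le> t \<Longrightarrow>
      distr P borel (\<lambda>\<omega>. X (s + t) \<omega> - X s \<omega>) = distr P borel (X t)"
    and cadlag_paths: "AE \<omega> in P. cadlag (\<lambda>t. X t \<omega>)"

definition covariance_matrix :: "real ^ 'd ^ 'd \<Rightarrow> bool" where
  "covariance_matrix C \<longleftrightarrow> transpose C = C \<and> (\<forall>u. 0 \<le> u \<bullet> (C *v u))"

definition levy_measure :: "(real ^ 'd) measure \<Rightarrow> bool" where
  "levy_measure F \<longleftrightarrow> sets F = sets borel \<and> emeasure F {0} = 0 \<and>
     (\<integral>\<^sup>+ x. ennreal (min 1 ((norm x)\<^sup>2)) \<partial>F) < \<infinity>"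

text \<open>Characteristic exponent with the truncation function \<open>x \<mapsto> x 1\<^bsub>|x| \<le> 1\<^esub>\<close>. Another
  truncation function only changes the drift \<open>b\<close>, hence not the modulus of the
  characteristic function.\<close>

definition levy_exponent ::
    "real ^ 'd \<Rightarrow> real ^ 'd ^ 'd \<Rightarrow> (real ^ 'd) measure \<Rightarrow> real ^ 'd \<Rightarrow> complex" where
  "levy_exponent b C F u =
     \<i> * of_real (u \<bullet> b) - of_real (u \<bullet> (C *v u)) / 2 +
     (CLINT x|F. iexp (u \<bullet> x) - 1 - \<i> * of_real ((u \<bullet> x) * indicator (cball 0 1) x))"

definition has_levy_triplet ::
    "'w measure \<Rightarrow> (real \<Rightarrow> 'w \<Rightarrow> real ^ 'd) \<Rightarrow>
     real ^ 'd \<Rightarrow> real ^ 'd ^ 'd \<Rightarrow> (real ^ 'd) measure \<Rightarrow> bool" where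
  "has_levy_triplet P X b C F \<longleftrightarrow> covariance_matrix C \<and> levy_measure F \<and>
     (\<forall>t\<ge>0. \<forall>u. (CLINT \<omega>|P. iexp (u \<bullet> X t \<omega>)) = exp (of_real t * levy_exponent b C F u))"

definition phi :: "'w measure \<Rightarrow> (real \<Rightarrow> 'w \<Rightarrow> real ^ 'd) \<Rightarrow> nat \<Rightarrow> real ^ 'd \<Rightarrow> complex" where
  "phi P X n u = (CLINT \<omega>|P. iexp (u \<bullet> X (1 / real n) \<omega>))"

definition norm_C :: "real ^ 2 ^ 2 \<Rightarrow> real" where
  "norm_C C = max \<bar>C $ 1 $ 1 + C $ 1 $ 2\<bar> \<bar>C $ 2 $ 1 + C $ 2 $ 2\<bar>"

text \<open>The integral takes values in \<open>[0, \<infinity>]\<close>, so the bound includes its finiteness. Since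
  \<open>0 powr 0 = 0\<close>, the integrand for \<open>r = 0\<close> is the indicator of \<open>x\<^sub>1 x\<^sub>2 \<noteq> 0\<close>.\<close>

definition cojump_bound :: "real ^ 2 ^ 2 \<Rightarrow> (real ^ 2) measure \<Rightarrow> real \<Rightarrow> real \<Rightarrow> bool" where
  "cojump_bound C F r M \<longleftrightarrow>
     ennreal (norm_C C) + (\<integral>\<^sup>+ x. ennreal (min 1 (\<bar>x $ 1 * x $ 2\<bar> powr (r / 2))) \<partial>F) < ennreal M"

definition C_sum :: "real ^ 2 ^ 2 \<Rightarrow> real" where
  "C_sum C = (\<Sum>i\<in>UNIV. \<Sum>j\<in>UNIV. C $ i $ j)"

text \<open>The function \<open>g\<close> and the constants belong to a fixed \<open>n\<close>. They cannot all be independent of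
  \<open>n\<close> when \<open>C_sum C > 0\<close>: for fixed \<open>U\<close> the characteristic function at \<open>(U, U)\<close> tends to 1 as
  \<open>n\<close> grows, whereas for fixed \<open>n\<close> it tends to 0 as \<open>U\<close> grows.\<close>

definition quasi_monotone :: "'w measure \<Rightarrow> (real \<Rightarrow> 'w \<Rightarrow> real ^ 2) \<Rightarrow> nat \<Rightarrow> bool" where
  "quasi_monotone P X n \<longleftrightarrow>
     (\<exists>(g :: real \<Rightarrow> real) L L'. mono_on {..<0} g \<and> antimono_on {0<..} g \<and> 0 < L \<and> 0 < L' \<and>
        (\<forall>U. \<forall>u \<in> {vector [U, U], vector [U, - U]}.
           L * g U \<le> norm (phi P X n u) \<and> norm (phi P X n u) \<le> L' * g U))"

definition U_start_oracle :: "'w measure \<Rightarrow> (real \<Rightarrow> 'w \<Rightarrow> real ^ 2) \<Rightarrow> nat \<Rightarrow> real" where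
  "U_start_oracle P X n = Inf {U. 0 < U \<and> norm (phi P X n (vector [U, U])) \<le> 1 / 2}"

definition U_cutoff :: "real \<Rightarrow> real \<Rightarrow> nat \<Rightarrow> real" where
  "U_cutoff r M n = sqrt ((r - 1) / M * real n * ln (real n))"

end

theory Submission
  imports Defs "HOL-Real_Asymp.Real_Asymp"
begin

text \<open>
  The modulus of the characteristic function is \<open>|\<phi>\<^sub>n(U)| = exp (- (C\<^sub>s\<^sub>u\<^sub>m U\<^sup>2 / 2 + h(U)) / n)\<close>, where
  \<open>h(U) = \<integral> (1 - cos (U (x\<^sub>1 + x\<^sub>2))) F(dx)\<close>, so \<open>|\<phi>\<^sub>n(U)| \<le> 1/2\<close> means
  \<open>C\<^sub>s\<^sub>u\<^sub>m U\<^sup>2 / 2 + h(U) \<ge> n ln 2\<close>. As \<open>h \<ge> 0\<close>, this holds at the right end point of the interval.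
  Conversely, \<open>h(U) \<le> (U\<^sup>2 + 2) I\<close> with \<open>I = \<integral> min 1 |x|\<^sup>2 F(dx)\<close>, so for large \<open>n\<close> it forces
  \<open>U\<^sup>2 \<ge> 2\<close>, whence \<open>h(U) \<le> 2 I U\<^sup>2\<close> and \<open>K = 4 I + 1\<close> works. The right end point is of order
  \<open>\<surd>n\<close>, hence eventually below \<open>U\<^sub>n\<close>.
\<close>

lemma one_minus_cos_le: "1 - cos t \<le> t\<^sup>2 / 2" for t :: real
proof -
  have "(sin (t / 2))\<^sup>2 \<le> (t / 2)\<^sup>2"
    using abs_sin_x_le_abs_x[of "t / 2"] by (simp only: abs_le_square_iff)
  moreover have "cos t = 1 - 2 * (sin (t / 2))\<^sup>2"
    using cos_double_sin[of "t / 2"] by simp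
  ultimately show ?thesis
    by (simp add: power_divide)
qed

text \<open>Inside the unit ball Cauchy-Schwarz gives a quadratic bound, outside it the trivial
  bound 2 suffices. Adding the two coefficients yields one constant for both regimes.\<close>

lemma one_minus_cos_inner_le:
  fixes u x :: "'a::real_inner"
  shows "1 - cos (u \<bullet> x) \<le> ((norm u)\<^sup>2 / 2 + 2) * min 1 ((norm x)\<^sup>2)"
proof (cases "(norm x)\<^sup>2 \<le> 1")
  case True
  have "\<bar>u \<bullet> x\<bar>\<^sup>2 \<le> (norm u * norm x)\<^sup>2"
    using Cauchy_Schwarz_ineq2[of u x] by (rule power_mono) simp
  then have "(u \<bullet> x)\<^sup>2 / 2 \<le> (norm u)\<^sup>2 / 2 * (norm x)\<^sup>2"
    by (simp add: power_mult_distrib)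
  also have "\<dots> \<le> ((norm u)\<^sup>2 / 2 + 2) * (norm x)\<^sup>2"
    by (rule mult_right_mono) auto
  finally show ?thesis
    using one_minus_cos_le[of "u \<bullet> x"] True by simp
next
  case False
  have "1 - cos (u \<bullet> x) \<le> 2"
    using cos_ge_minus_one[of "u \<bullet> x"] by linarith
  also have "\<dots> \<le> (norm u)\<^sup>2 / 2 + 2"
    by simp
  finally show ?thesis
    using False by simp
qed

lemma levy_measure_integrable:
  assumes "levy_measure F"
  shows "integrable F (\<lambda>x. min 1 ((norm x)\<^sup>2))"
proof (rule integrableI_nonneg)
  have [measurable_cong]: "sets F = sets borel"
    using assms by (simp add: levy_measure_def)
  show "(\<lambda>x. min 1 ((norm x)\<^sup>2)) \<in> borel_measurable F"
    by measurable
qed (use assms in \<open>auto simp: levy_measure_def\<close>)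

text \<open>The drift and the compensator are purely imaginary, so only the Gaussian term and the
  integral of \<open>cos (u \<bullet> x) - 1\<close> affect the real part.\<close>

lemma Re_levy_exponent_bounds:
  assumes "levy_measure F"
  defines "I \<equiv> (LINT x|F. min 1 ((norm x)\<^sup>2))"
  shows "Re (levy_exponent b C F u) \<le> - (u \<bullet> (C *v u)) / 2"
    and "- (u \<bullet> (C *v u)) / 2 - ((norm u)\<^sup>2 / 2 + 2) * I \<le> Re (levy_exponent b C F u)"
proof -
  define k where
    "k = (\<lambda>x. iexp (u \<bullet> x) - 1 - \<i> * of_real ((u \<bullet> x) * indicator (cball 0 1) x))"
  have Re_k: "Re (k x) = cos (u \<bullet> x) - 1" for x
    by (simp add: k_def Re_exp)
  have Re_exponent: "Re (levy_exponent b C F u) = - (u \<bullet> (C *v u)) / 2 + Re (CLINT x|F. k x)"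
    by (simp add: levy_exponent_def k_def)
  have "0 \<le> I"
    unfolding I_def by (rule integral_nonneg_AE) simp
  have "Re (CLINT x|F. k x) \<le> 0 \<and> - (((norm u)\<^sup>2 / 2 + 2) * I) \<le> Re (CLINT x|F. k x)"
  proof (cases "integrable F k")
    case True
    then have Re_int: "Re (CLINT x|F. k x) = (LINT x|F. Re (k x))"
      by simp
    have "0 \<le> (LINT x|F. - Re (k x))"
      by (rule integral_nonneg_AE) (simp add: Re_k)
    moreover have "(LINT x|F. - Re (k x)) \<le> (LINT x|F. ((norm u)\<^sup>2 / 2 + 2) * min 1 ((norm x)\<^sup>2))"
    proof (rule integral_mono)
      show "integrable F (\<lambda>x. - Re (k x))"
        using True by (intro integrable_minus integrable_Re)
    qed (use levy_measure_integrable[OF assms(1)] one_minus_cos_inner_le[of u] in \<open>auto simp: Re_k\<close>)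
    ultimately show ?thesis
      by (simp add: Re_int I_def)
  next
    \<comment> \<open>The Bochner integral of a non-integrable function is 0 by convention, so both
      bounds hold and integrability of \<open>k\<close> need not be shown.\<close>
    case False
    then show ?thesis
      using \<open>0 \<le> I\<close> by (simp add: not_integrable_integral_eq)
  qed
  then show "Re (levy_exponent b C F u) \<le> - (u \<bullet> (C *v u)) / 2"
    and "- (u \<bullet> (C *v u)) / 2 - ((norm u)\<^sup>2 / 2 + 2) * I \<le> Re (levy_exponent b C F u)"
    by (auto simp: Re_exponent)
qed

lemma norm_phi:
  assumes "has_levy_triplet P X b C F"
  shows "norm (phi P X n u) = exp (Re (levy_exponent b C F u) / n)"
  using assms by (simp add: has_levy_triplet_def phi_def)

text \<open>Take logarithms. At \<open>n = 0\<close> the time \<open>1 / real n\<close> is 0 and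
  \<open>phi\<close> is 1, so the left side fails although the right side holds.\<close>

lemma norm_phi_le_half_iff:
  assumes "has_levy_triplet P X b C F" and "0 < n"
  shows "norm (phi P X n u) \<le> 1 / 2 \<longleftrightarrow> n * ln 2 \<le> - Re (levy_exponent b C F u)"
proof -
  have "norm (phi P X n u) \<le> 1 / 2 \<longleftrightarrow> exp (Re (levy_exponent b C F u) / n) \<le> exp (- ln 2)"
    by (simp add: norm_phi[OF assms(1)] exp_minus inverse_eq_divide)
  also have "\<dots> \<longleftrightarrow> n * ln 2 \<le> - Re (levy_exponent b C F u)"
    using assms(2) by (simp add: field_simps) linarith
  finally show ?thesis .
qed

lemma inner_matrix_diagonal:
  "vector [U, U] \<bullet> (C *v vector [U, U]) = C_sum C * U\<^sup>2" for C :: "real ^ 2 ^ 2"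
  by (simp add: inner_vec_def matrix_vector_mult_def C_sum_def sum_2 algebra_simps power2_eq_square)

lemma norm_diagonal: "(norm (vector [U, U] :: real ^ 2))\<^sup>2 = 2 * U\<^sup>2"
  unfolding power2_norm_eq_inner by (simp add: inner_vec_def sum_2 power2_eq_square)

theorem lemma4p3:
  fixes P :: "'w measure" and X :: "real \<Rightarrow> 'w \<Rightarrow> real ^ 2"
    and b :: "real ^ 2" and C :: "real ^ 2 ^ 2" and F :: "(real ^ 2) measure"
    and r M :: real
  assumes "levy_process P X"
    and "has_levy_triplet P X b C F"
    and "0 < M"
    and "cojump_bound C F r M"
    and "0 < C_sum C"
    and "\<And>n. 1 \<le> n \<Longrightarrow> quasi_monotone P X n"
  shows "\<exists>K>0. \<forall>\<^sub>F n in sequentially.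
    U_start_oracle P X n \<in> {sqrt (2 * ln 2) / sqrt (C_sum C + K) * sqrt (real n) ..
                            sqrt (2 * ln 2) / sqrt (C_sum C) * sqrt (real n)} \<and>
    (r \<in> {1<..2} \<longrightarrow> U_start_oracle P X n < U_cutoff r M n)"
proof -
  have F: "levy_measure F"
    using assms(2) by (simp add: has_levy_triplet_def)
  define I where "I = (LINT x|F. min 1 ((norm x)\<^sup>2))"
  have "0 \<le> I"
    unfolding I_def by (rule integral_nonneg_AE) simp
  define c where "c = C_sum C"
  have "0 < c"
    using assms(5) by (simp add: c_def)
  define h where "h U = - Re (levy_exponent b C F (vector [U, U]))" for U
  have h_ge: "c * U\<^sup>2 / 2 \<le> h U" and h_le: "h U \<le> c * U\<^sup>2 / 2 + (U\<^sup>2 + 2) * I" for U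
    using Re_levy_exponent_bounds[OF F, where b = b and C = C and u = "vector [U, U]"]
    by (simp_all add: h_def I_def c_def inner_matrix_diagonal norm_diagonal)
  define S where "S n = {U. 0 < U \<and> norm (phi P X n (vector [U, U])) \<le> 1 / 2}" for n
  have S_iff: "U \<in> S n \<longleftrightarrow> 0 < U \<and> n * ln 2 \<le> h U" if "0 < n" for U n
    using norm_phi_le_half_iff[OF assms(2) that] by (simp add: S_def h_def)
  \<comment> \<open>\<open>4 * I\<close> absorbs the jump bound, since
    \<open>2 * U\<^sup>2 * I = 4 * I * U\<^sup>2 / 2\<close>; the summand 1 keeps \<open>K\<close>
    positive when \<open>I = 0\<close>.\<close>
  define K where "K = 4 * I + 1"
  have "0 < K"
    using \<open>0 \<le> I\<close> by (simp add: K_def)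

  \<comment> \<open>Besides bounding the infimum from above, this shows that \<open>S n\<close> is
    nonempty, without which \<open>cInf_greatest\<close> does not apply.\<close>
  have upper: "sqrt (2 * ln 2) / sqrt c * sqrt n \<in> S n" if "0 < n" for n
  proof -
    define U where "U = sqrt (2 * ln 2) / sqrt c * sqrt n"
    have "0 < U"
      using that \<open>0 < c\<close> by (simp add: U_def)
    moreover have "c * U\<^sup>2 / 2 = n * ln 2"
      using \<open>0 < c\<close> by (simp add: U_def power_mult_distrib power_divide)
    ultimately show ?thesis
      using h_ge[of U] S_iff[OF that] by (simp add: U_def)
  qed

  have lower: "sqrt (2 * ln 2) / sqrt (c + K) * sqrt n \<le> U"
    if "U \<in> S n" "0 < n" "c + 4 * I < n * ln 2" for U n
  proof -
    have "0 < U" and nh: "n * ln 2 \<le> h U"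
      using S_iff that by auto
    have "2 \<le> U\<^sup>2"
    proof (rule ccontr)
      assume "\<not> 2 \<le> U\<^sup>2"
      \<comment> \<open>For such \<open>U\<close> the exponent \<open>h U\<close> is at most
        \<open>c + 4 * I\<close>, which is below \<open>n * ln 2\<close>.\<close>
      then have "c * U\<^sup>2 \<le> c * 2" "(U\<^sup>2 + 2) * I \<le> 4 * I"
        using \<open>0 < c\<close> \<open>0 \<le> I\<close> by (auto intro!: mult_left_mono mult_right_mono)
      then show False
        using nh h_le[of U] that(3) by linarith
    qed
    then have "(U\<^sup>2 + 2) * I \<le> (2 * U\<^sup>2) * I"
      using \<open>0 \<le> I\<close> by (intro mult_right_mono) auto
    then have "n * ln 2 \<le> c * U\<^sup>2 / 2 + 2 * U\<^sup>2 * I"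
      using nh h_le[of U] by linarith
    also have "\<dots> \<le> (c + K) * U\<^sup>2 / 2"
      by (simp add: K_def algebra_simps)
    finally have "2 * ln 2 / (c + K) * n \<le> U\<^sup>2"
      using \<open>0 < c\<close> \<open>0 < K\<close> by (simp add: field_simps)
    then have "sqrt (2 * ln 2 / (c + K) * n) \<le> U"
      using \<open>0 < U\<close> by (intro real_le_lsqrt) auto
    then show ?thesis
      by (simp add: real_sqrt_mult real_sqrt_divide)
  qed

  have large: "\<forall>\<^sub>F n in sequentially. c + 4 * I < real n * ln 2"
    by real_asymp
  have cutoff: "\<forall>\<^sub>F n in sequentially. r \<in> {1<..2} \<longrightarrow>
      sqrt (2 * ln 2) / sqrt c * sqrt (real n) < U_cutoff r M n"
  proof (cases "1 < r")
    case True
    then have "0 < (r - 1) / M"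
      using \<open>0 < M\<close> by simp
    \<comment> \<open>These are the squares of the right end point and of the cutoff, each divided
      by \<open>n\<close>: one is constant, the other grows like \<open>ln n\<close>.\<close>
    then have "\<forall>\<^sub>F n in sequentially. 2 * ln 2 / c < (r - 1) / M * ln (real n)"
      by real_asymp
    then show ?thesis
      using eventually_gt_at_top[of 0]
    proof eventually_elim
      case (elim n)
      then have "2 * ln 2 / c * n < (r - 1) / M * ln n * n"
        by (intro mult_strict_right_mono) auto
      then have "sqrt (2 * ln 2 / c * n) < U_cutoff r M n"
        by (simp add: U_cutoff_def mult_ac)
      then show ?case
        by (simp add: real_sqrt_mult real_sqrt_divide)
    qed
  qed auto

  have "\<forall>\<^sub>F n in sequentially.
    U_start_oracle P X n \<in> {sqrt (2 * ln 2) / sqrt (c + K) * sqrt (real n) ..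
                            sqrt (2 * ln 2) / sqrt c * sqrt (real n)} \<and>
    (r \<in> {1<..2} \<longrightarrow> U_start_oracle P X n < U_cutoff r M n)"
    using large cutoff eventually_gt_at_top[of 0]
  proof eventually_elim
    case (elim n)
    have "U_start_oracle P X n = Inf (S n)"
      by (simp add: U_start_oracle_def S_def)
    moreover have "Inf (S n) \<le> sqrt (2 * ln 2) / sqrt c * sqrt n"
      using upper elim by (intro cInf_lower bdd_belowI[of _ 0]) (auto simp: S_def)
    moreover have "sqrt (2 * ln 2) / sqrt (c + K) * sqrt n \<le> Inf (S n)"
      using upper lower elim by (intro cInf_greatest) auto
    ultimately show ?case
      using elim by auto
  qed
  then show ?thesis
    using \<open>0 < K\<close> by (auto simp: c_def)
qed

end
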